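(* Let $n$ and $r$ be integers with $n \geq r \geq 2$. Then the sign pattern $\mathcal{K}_{n,r}$ is a minimal spectrally arbitrary pattern (MSAP).
   Context: A sign pattern is a matrix with entries in $\{+,-,0\}$. For a real number $a$, $\mathrm{sgn}(a)$ is $+$, $0$ or $-$ according to whether $a$ is positive, zero or negative. For an $m\times n$ sign pattern $\mathcal{S}=[s_{ij}]$, its sign pattern class is $Q(\mathcal{S})=\{A=[a_{ij}]\in\mathbb{R}^{m\times n} : \mathrm{sgn}(a_{ij})=s_{ij}\text{ for all } i,j\}$. For $m \times n$ sign patterns $\mathcal{S}=[s_{ij}]$ and $\mathcal{U}=[u_{ij}]$, if $u_{ij}=s_{ij}$ whenever $s_{ij}\neq 0$, then $\mathcal{U}$ is a superpattern of $\mathcal{S}$ and $\mathcal{S}$ is a subpattern of $\mathcal{U}$; a proper subpattern of $\mathcal{U}$ is a subpattern different from $\mathcal{U}$ itself. An $n\times n$ sign pattern $\mathcal{S}$ is a spectrally arbitrary pattern (SAP) if every monic real polynomial of degree $n$ is the characteristic polynomial of some matrix in $Q(\mathcal{S})$ (equivalently, every self-conjugate multi-list of $n$ complex numbers is the spectrum of some matrix in $Q(\mathcal{S})$). $\mathcal{S}$ is a minimal spectrally arbitrary pattern (MSAP) if $\mathcal{S}$ is a SAP and no proper subpattern of $\mathcal{S}$ is a SAP. For integers $2\le r\le n$, $\mathcal{K}_{n,r}$ is the $n\times n$ sign pattern whose nonzero entries are exactly the following: the $(i,1)$ entry is $+$ for $1\le i\le n-1$; the $(i,i+1)$ entry is $-$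 for $1\le i\le n-1$; the $(n,n)$ entry is $-$; and the $(n,n-r+1)$ entry is $+$. All other entries are $0$. *)

theory Defs
  imports Complex_Main "Jordan_Normal_Form.Char_Poly"
begin

datatype sign = Plus_sign | Minus_sign | Zero_sign

definition sign_of :: "real \<Rightarrow> sign" where
  "sign_of a = (if a > 0 then Plus_sign else if a < 0 then Minus_sign else Zero_sign)"

type_synonym sign_pattern = "sign mat"

definition pattern_class :: "sign_pattern \<Rightarrow> real mat set" where
  "pattern_class S = {A \<in> carrier_mat (dim_row S) (dim_col S).
     \<forall>i < dim_row S. \<forall>j < dim_col S. sign_of (A $$ (i, j)) = S $$ (i, j)}"

definition subpattern :: "sign_pattern \<Rightarrow> sign_pattern \<Rightarrow> bool" where
  "subpattern S U \<longleftrightarrow> dim_row S = dim_row U \<and> dim_col S = dim_col U \<and>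
     (\<forall>i < dim_row S. \<forall>j < dim_col S.
        S $$ (i, j) \<noteq> Zero_sign \<longrightarrow> U $$ (i, j) = S $$ (i, j))"

definition proper_subpattern :: "sign_pattern \<Rightarrow> sign_pattern \<Rightarrow> bool" where
  "proper_subpattern S U \<longleftrightarrow> subpattern S U \<and> S \<noteq> U"

definition spectrally_arbitrary :: "sign_pattern \<Rightarrow> bool" where
  "spectrally_arbitrary S \<longleftrightarrow> square_mat S \<and>
     (\<forall>p :: real poly. lead_coeff p = 1 \<and> degree p = dim_row S \<longrightarrow>
        (\<exists>A \<in> pattern_class S. char_poly A = p))"

definition minimal_spectrally_arbitrary :: "sign_pattern \<Rightarrow> bool" where
  "minimal_spectrally_arbitrary S \<longleftrightarrow> spectrally_arbitrary S \<and>
     (\<forall>T. proper_subpattern T S \<longrightarrow> \<not> spectrally_arbitrary T)"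

(* Matrix entries are indexed from 0; K_entry takes row and column numbers i, j
   in {1..n}.  The nonzero positions are pairwise distinct for 2 \<le> r \<le> n, so the order
   of the case distinction is immaterial there. *)
definition K_entry :: "nat \<Rightarrow> nat \<Rightarrow> nat \<Rightarrow> nat \<Rightarrow> sign" where
  "K_entry n r i j =
     (if i \<le> n - 1 \<and> j = 1 then Plus_sign
      else if i \<le> n - 1 \<and> j = i + 1 then Minus_sign
      else if i = n \<and> j = n then Minus_sign
      else if i = n \<and> j = n - r + 1 then Plus_sign
      else Zero_sign)"

definition K_pattern :: "nat \<Rightarrow> nat \<Rightarrow> sign_pattern" where
  "K_pattern n r = mat n n (\<lambda>(i, j). K_entry n r (i + 1) (j + 1))"

end

(*
  Let A be a matrix in the closure of the class of K_{n,r}, with first column a_1, ..., a_{n-1},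
  superdiagonal -d_1, ..., -d_{n-1}, corner entry -c and remaining last-row entry b.  It is
  Hessenberg, and with A_0 = 1, A_k = a_k d_1 ... d_{k-1} (k < n), A_n = 0 and
  B = b d_{n-r+1} ... d_{n-1} the coefficient of x^(n-k) in its characteristic polynomial is
  (-1)^k (A_k - c A_{k-1} + B A_{k-r}), the last term being absent for k < r.

  Minimality: if a subpattern is spectrally arbitrary, a positive x^(n-1)-coefficient forces c > 0,
  a determinant of sign (-1)^n forces B > 0, and given these, the polynomial x^n forces all
  A_k > 0.  Together these account for every nonzero entry of K_{n,r}.

  Spectral arbitrariness: prescribe q_k = A_k - c A_{k-1} + B A_{k-r}, and put d = 1, c = 1/e,
  B = x/e^r, A_k = g_k/e^k.  Then g_k = g_{k-1} - x g_{k-r} + q_k e^k, and a small e and some x > 0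
  are needed with g_1, ..., g_{n-1} > 0 and g_n = 0.  For e = 0 there is an interval [0, u] on
  which g_1, ..., g_{n-1} are positive and g_n changes sign; this survives a small perturbation,
  and the intermediate value theorem gives x.
*)

theory Submission
  imports Defs
begin

section \<open>Determinants of Hessenberg matrices\<close>

text \<open>This is a Hessenberg matrix of size m + 1 without its last row and its column s. While s
  < m, its last column vanishes above the bottom entry, so Laplace expansion along it strips off one
  superdiagonal entry at a time until the leading block of size s remains.\<close>

lemma det_hessenberg_minor:
  fixes f :: "nat \<Rightarrow> nat \<Rightarrow> 'a :: comm_ring_1"
  assumes hess: "\<And>i j. Suc i < j \<Longrightarrow> f i j = 0" and "s \<le> m"
  shows "det (mat m m (\<lambda>(i, j). f i (if j < s then j else Suc j))) =
           (\<Prod>i = s..<m. f i (Suc i)) * det (mat s s (\<lambda>(i, j). f i j))"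
  using \<open>s \<le> m\<close>
proof (induction m)
  case 0
  then show ?case by simp
next
  case (Suc m)
  show ?case
  proof (cases "s = Suc m")
    case True
    have "mat s s (\<lambda>(i, j). f i (if j < s then j else Suc j)) = mat s s (\<lambda>(i, j). f i j)"
      by (intro eq_matI) auto
    then show ?thesis using True by simp
  next
    case False
    with Suc.prems have s: "s \<le> m" by simp
    let ?g = "\<lambda>(i, j). f i (if j < s then j else Suc j)"
    let ?M = "mat (Suc m) (Suc m) ?g"
    have entry: "?M $$ (i, m) = (if i = m then f m (Suc m) else 0)" if "i < Suc m" for i
      using that s hess[of i "Suc m"] by auto
    have minor: "mat_delete ?M m m = mat m m ?g"
      by (intro eq_matI) (auto simp: mat_delete_def)
    have "det ?M = (\<Sum>i<Suc m. ?M $$ (i, m) * cofactor ?M i m)"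
      by (rule laplace_expansion_column) auto
    also have "\<dots> = (\<Sum>i<Suc m. if i = m then f m (Suc m) * cofactor ?M m m else 0)"
      using entry by (intro sum.cong) auto
    also have "\<dots> = f m (Suc m) * det (mat m m ?g)"
      by (simp add: cofactor_def minor)
    finally show ?thesis
      using Suc.IH[OF s] s by (simp add: mult_ac)
  qed
qed

text \<open>Expansion along the last row, with the minors evaluated as above, gives a recursion for
  the leading principal minors.\<close>

lemma det_hessenberg:
  fixes f :: "nat \<Rightarrow> nat \<Rightarrow> 'a :: comm_ring_1"
  assumes "\<And>i j. Suc i < j \<Longrightarrow> f i j = 0"
  shows "det (mat (Suc m) (Suc m) (\<lambda>(i, j). f i j)) =
    (\<Sum>s\<le>m. f m s * ((-1) ^ (m + s) * ((\<Prod>i = s..<m. f i (Suc i)) *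
       det (mat s s (\<lambda>(i, j). f i j)))))"
proof -
  let ?M = "mat (Suc m) (Suc m) (\<lambda>(i, j). f i j)"
  have minor: "mat_delete ?M m s = mat m m (\<lambda>(i, j). f i (if j < s then j else Suc j))"
    if "s \<le> m" for s
    using that by (intro eq_matI) (auto simp: mat_delete_def)
  have "det ?M = (\<Sum>s<Suc m. ?M $$ (m, s) * cofactor ?M m s)"
    by (rule laplace_expansion_row) auto
  also have "\<dots> = (\<Sum>s\<le>m. f m s * ((-1) ^ (m + s) * ((\<Prod>i = s..<m. f i (Suc i)) *
       det (mat s s (\<lambda>(i, j). f i j)))))"
    unfolding lessThan_Suc_atMost
    by (intro sum.cong refl) (simp add: cofactor_def minor det_hessenberg_minor[where f = f, OF assms])
  finally show ?thesis .
qed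

section \<open>The characteristic polynomial\<close>

text \<open>Rows, columns and the arguments of \<open>a\<close> and \<open>d\<close> are counted from 0, so that
  \<open>a i\<close> and \<open>d i\<close> are \<open>a\<close> and \<open>d\<close> with subscript \<open>i + 1\<close> in the explanation above.\<close>

definition K_mat :: "nat \<Rightarrow> nat \<Rightarrow> (nat \<Rightarrow> real) \<Rightarrow> (nat \<Rightarrow> real) \<Rightarrow> real \<Rightarrow> real \<Rightarrow> real mat" where
  "K_mat n r a d c b = mat n n (\<lambda>(i, j).
     if i < n - 1 \<and> j = 0 then a i
     else if i < n - 1 \<and> j = i + 1 then - d i
     else if i = n - 1 \<and> j = n - 1 then - c
     else if i = n - 1 \<and> j = n - r then b
     else 0)"

text \<open>This is A_k for k < n. The convention A_n = 0 is not built in; it appears as the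
  condition \<open>k < n\<close> in the coefficient formula.\<close>

definition K_coeff :: "(nat \<Rightarrow> real) \<Rightarrow> (nat \<Rightarrow> real) \<Rightarrow> nat \<Rightarrow> real" where
  "K_coeff a d k = (if k = 0 then 1 else a (k - 1) * (\<Prod>i<k - 1. d i))"

lemma K_coeff_0 [simp]: "K_coeff a d 0 = 1"
  by (simp add: K_coeff_def)

lemma prod_const_poly:
  fixes f :: "'b \<Rightarrow> 'a :: comm_ring_1"
  shows "(\<Prod>x\<in>A. [:f x:]) = [:\<Prod>x\<in>A. f x:]"
  by (induction A rule: infinite_finite_induct) (auto simp: one_pCons)

text \<open>For m < n - 1 the leading blocks of xI - A satisfy D_(m+1) = x D_m + (-1)^(m+1) A_(m+1).
  The last row adds (x + c) D_(n-1) and a multiple of D_(n-r).\<close>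

lemma coeff_char_poly_K_mat:
  assumes r: "2 \<le> r" "r \<le> n" and k: "1 \<le> k" "k \<le> n"
  shows "coeff (char_poly (K_mat n r a d c b)) (n - k) =
    (-1) ^ k * ((if k < n then K_coeff a d k else 0) - c * K_coeff a d (k - 1) +
      (if r \<le> k then b * (\<Prod>i = n - r..<n - 1. d i) * K_coeff a d (k - r) else 0))"
proof -
  define f :: "nat \<Rightarrow> nat \<Rightarrow> real poly" where
    "f = (\<lambda>i j. (if i = j then [:0, 1:] else 0) -
       (if i < n - 1 \<and> j = 0 then [:a i:]
        else if i < n - 1 \<and> j = i + 1 then [:- d i:]
        else if i = n - 1 \<and> j = n - 1 then [:- c:]
        else if i = n - 1 \<and> j = n - r then [:b:] else 0))"
  have hess: "f i j = 0" if "Suc i < j" for i j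
    using that r by (auto simp: f_def)
  have sup: "f i (Suc i) = [:d i:]" if "i < n - 1" for i
    using that by (simp add: f_def)
  let ?D = "\<lambda>m. det (mat m m (\<lambda>(i, j). f i j))"
  \<comment> \<open>The closed form of the solution of the recursion for D_m.\<close>
  define Q where "Q m = (\<Sum>k\<le>m. monom ((-1) ^ k * K_coeff a d k) (m - k))" for m
  have prod_d: "(\<Prod>i = s..<m. f i (Suc i)) = [:\<Prod>i = s..<m. d i:]" if "m \<le> n - 1" for s m
    unfolding prod_const_poly[symmetric] using that by (intro prod.cong) (auto simp: sup)
  have Q_Suc: "Q (Suc m) = [:0, 1:] * Q m + [:(-1) ^ Suc m * K_coeff a d (Suc m):]" for m
  proof -
    have "[:0, 1:] * Q m = (\<Sum>k\<le>m. monom ((-1) ^ k * K_coeff a d k) (Suc m - k))"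
      unfolding Q_def sum_distrib_left by (intro sum.cong) (auto simp: monom_Suc Suc_diff_le)
    then show ?thesis by (simp add: Q_def monom_0)
  qed
  have D_Q: "?D m = Q m" if "m \<le> n - 1" for m
    using that
  proof (induction m)
    case 0
    then show ?case by (simp add: Q_def monom_0 one_pCons)
  next
    case (Suc m)
    let ?t = "\<lambda>s. (-1) ^ (m + s) * ((\<Prod>i = s..<m. f i (Suc i)) * ?D s)"
    have "?D (Suc m) = (\<Sum>s\<le>m. f m s * ?t s)"
      by (rule det_hessenberg[OF hess])
    \<comment> \<open>A difference of two conditionals, since for m = 0 the diagonal entry and the
      entry in column 0 coincide.\<close>
    also have "\<dots> = (\<Sum>s\<le>m. (if s = m then [:0, 1:] * ?t m else 0) - (if s = 0 then [:a m:] * ?t 0 else 0))"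
      using Suc.prems by (intro sum.cong) (auto simp: f_def algebra_simps)
    also have "\<dots> = [:0, 1:] * ?t m - [:a m:] * ?t 0"
      by (simp add: sum_subtractf)
    also have "?t m = Q m"
      using Suc by simp
    also have "[:a m:] * ?t 0 = - [:(-1) ^ Suc m * K_coeff a d (Suc m):]"
      using Suc.prems by (simp add: prod_d K_coeff_def lessThan_atLeast0 minus_one_power_iff)
    finally show ?case by (simp only: Q_Suc diff_minus_eq_add)
  qed
  have coeff_Q: "coeff (Q m) j = (if j \<le> m then (-1) ^ (m - j) * K_coeff a d (m - j) else 0)" for m j
  proof -
    have "coeff (Q m) j = (\<Sum>k\<le>m. if k = m - j then (if j \<le> m then (-1) ^ k * K_coeff a d k else 0) else 0)"
      unfolding Q_def coeff_sum coeff_monom by (intro sum.cong) auto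
    then show ?thesis by simp
  qed
  obtain N where N: "n = Suc N" using r by (cases n) auto
  let ?E = "\<Prod>i = n - r..<n - 1. d i"
  let ?t = "\<lambda>s. (-1) ^ (N + s) * ((\<Prod>i = s..<N. f i (Suc i)) * ?D s)"
  have "char_poly (K_mat n r a d c b) = ?D n"
    unfolding char_poly_def char_poly_matrix_def
    by (intro arg_cong[where f = det] eq_matI) (auto simp: K_mat_def f_def)
  also have "\<dots> = (\<Sum>s\<le>N. f N s * ?t s)"
    unfolding N by (rule det_hessenberg[OF hess])
  also have "\<dots> = (\<Sum>s\<le>N. (if s = N then [:c, 1:] * ?t N else 0) - (if s = n - r then [:b:] * ?t (n - r) else 0))"
    using r N by (intro sum.cong) (auto simp: f_def algebra_simps)
  also have "\<dots> = [:c, 1:] * ?t N - [:b:] * ?t (n - r)"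
    using r N by (simp add: sum_subtractf)
  also have "?t N = Q N"
    using D_Q[of N] N by simp
  also have "?t (n - r) = (-1) ^ (N + (n - r)) * ([:?E:] * Q (n - r))"
    using D_Q[of "n - r"] r N by (simp add: prod_d)
  finally have char_poly: "char_poly (K_mat n r a d c b) =
    [:c, 1:] * Q N - [:b:] * ((-1) ^ (N + (n - r)) * ([:?E:] * Q (n - r)))" .
  have neg_one: "(-1) ^ i = [:(-1) ^ i :: real:]" for i
    by (induction i) (auto simp: one_pCons)
  have 1: "coeff ([:c, 1:] * Q N) (n - k) =
      (-1) ^ k * ((if k < n then K_coeff a d k else 0) - c * K_coeff a d (k - 1))"
  \<comment> \<open>In the constant coefficient the factor x contributes nothing, which is why A_n
    counts as 0.\<close>
  proof (cases "k = n")
    case True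
    then show ?thesis using N by (simp add: coeff_Q)
  next
    case False
    then have "n - k = Suc (N - k)" "k \<le> N" "Suc (N - k) \<le> N" "N - Suc (N - k) = k - 1"
      using k N by auto
    moreover have "(-1 :: real) ^ k = - ((-1) ^ (k - 1))"
      using k by (cases k) auto
    ultimately show ?thesis using N False k
      by (simp add: coeff_Q algebra_simps)
  qed
  have 2: "coeff ([:b:] * ((-1) ^ (N + (n - r)) * ([:?E:] * Q (n - r)))) (n - k) =
      - ((-1) ^ k * (if r \<le> k then b * ?E * K_coeff a d (k - r) else 0))"
  proof (cases "r \<le> k")
    case True
    then obtain u where u: "k = r + u" by (metis le_Suc_ex)
    \<comment> \<open>The exponent is 2n - 1 - r + u, of parity opposite to k = r + u.\<close>
    have sign: "(-1) ^ (N + (n - r)) * (-1) ^ u = - ((-1 :: real) ^ k)"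
      using r N u by (auto simp: minus_one_power_iff)
    have "n - k \<le> n - r" "n - r - (n - k) = u"
      using k u by auto
    then have "coeff ([:b:] * ((-1) ^ (N + (n - r)) * ([:?E:] * Q (n - r)))) (n - k) =
        ((-1) ^ (N + (n - r)) * (-1) ^ u) * (b * ?E * K_coeff a d u)"
      by (simp add: neg_one coeff_Q mult_ac)
    then show ?thesis unfolding sign using u by simp
  next
    case False
    with r k have "\<not> n - k \<le> n - r" by linarith
    with False show ?thesis by (simp add: neg_one coeff_Q)
  qed
  show ?thesis unfolding char_poly coeff_diff 1 2 by (auto simp: algebra_simps)
qed

section \<open>Parameters for the pattern class and for subpatterns\<close>

lemma carrier_K_mat [simp]: "K_mat n r a d c b \<in> carrier_mat n n"
  by (simp add: K_mat_def)

lemma K_mat_in_pattern_class: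
  assumes r: "2 \<le> r" "r \<le> n"
    and "\<And>i. i < n - 1 \<Longrightarrow> 0 < a i" "\<And>i. i < n - 1 \<Longrightarrow> 0 < d i" "0 < c" "0 < b"
  shows "K_mat n r a d c b \<in> pattern_class (K_pattern n r)"
proof -
  have "sign_of (K_mat n r a d c b $$ (i, j)) = K_entry n r (i + 1) (j + 1)" if ij: "i < n" "j < n" for i j
  proof (cases "i < n - 1")
    case True
    then have "i + 1 \<le> n - 1" "i + 1 \<noteq> n" "i \<noteq> n - 1" by auto
    with True show ?thesis
      using assms(3)[of i] assms(4)[of i] ij by (simp add: K_mat_def K_entry_def sign_of_def)
  next
    case False
    with ij have "i = n - 1" by simp
    \<comment> \<open>Translation to indices from 0 in the last row; r >= 2 keeps its two nonzero
      entries apart.\<close>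
    moreover have "j + 1 = n \<longleftrightarrow> j = n - 1" "j + 1 = n - r + 1 \<longleftrightarrow> j = n - r" "n - 1 + 1 = n" "n - r \<noteq> n - 1"
      "\<not> n \<le> n - 1"
      using r by auto
    ultimately show ?thesis
      using assms(5,6) ij by (auto simp: K_mat_def K_entry_def sign_of_def)
  qed
  then show ?thesis by (simp add: pattern_class_def K_pattern_def K_mat_def)
qed

text \<open>The first part transfers signs found in a realization to T; the second restricts the
  signs that a realization can have.\<close>

lemma subpattern_K_pattern_entry:
  assumes "subpattern T (K_pattern n r)" "A \<in> pattern_class T" "i < n" "j < n"
  shows "sign_of (A $$ (i, j)) = T $$ (i, j)"
    and "A $$ (i, j) \<noteq> 0 \<Longrightarrow> T $$ (i, j) = K_entry n r (i + 1) (j + 1)"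
proof -
  show "sign_of (A $$ (i, j)) = T $$ (i, j)"
    using assms by (auto simp: subpattern_def pattern_class_def K_pattern_def)
  then show "T $$ (i, j) = K_entry n r (i + 1) (j + 1)" if "A $$ (i, j) \<noteq> 0"
    using assms that by (auto simp: subpattern_def K_pattern_def sign_of_def split: if_splits)
qed

text \<open>Entries deleted from the pattern become zero parameters, hence only weak
  inequalities.\<close>

lemma subpattern_K_pattern_K_mat:
  fixes A :: "real mat"
  assumes r: "2 \<le> r" "r \<le> n"
    and T: "subpattern T (K_pattern n r)" and A: "A \<in> pattern_class T"
  obtains a d c b where
    "A = K_mat n r a d c b" "\<And>i. i < n - 1 \<Longrightarrow> 0 \<le> a i" "\<And>i. i < n - 1 \<Longrightarrow> 0 \<le> d i"
    "0 \<le> c" "0 \<le> b"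
proof
  let ?a = "\<lambda>i. A $$ (i, 0)" and ?d = "\<lambda>i. - A $$ (i, i + 1)"
  let ?c = "- A $$ (n - 1, n - 1)" and ?b = "A $$ (n - 1, n - r)"
  note entry = subpattern_K_pattern_entry[OF T A]
  have A_carrier: "A \<in> carrier_mat n n"
    using T A by (simp add: pattern_class_def subpattern_def K_pattern_def)
  have zero: "A $$ (i, j) = 0" if "i < n" "j < n" "K_entry n r (i + 1) (j + 1) = Zero_sign" for i j
    using entry[of i j] that by (auto simp: sign_of_def split: if_splits)
  have nonneg: "0 \<le> A $$ (i, j)" if "i < n" "j < n" "K_entry n r (i + 1) (j + 1) = Plus_sign" for i j
    using entry[of i j] that by (auto simp: sign_of_def split: if_splits)
  have nonpos: "A $$ (i, j) \<le> 0" if "i < n" "j < n" "K_entry n r (i + 1) (j + 1) = Minus_sign" for i j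
    using entry[of i j] that by (auto simp: sign_of_def split: if_splits)
  show "A = K_mat n r ?a ?d ?c ?b"
  proof (rule eq_matI)
    fix i j assume "i < dim_row (K_mat n r ?a ?d ?c ?b)" "j < dim_col (K_mat n r ?a ?d ?c ?b)"
    then have "i < n" "j < n" by (auto simp: K_mat_def)
    then show "A $$ (i, j) = K_mat n r ?a ?d ?c ?b $$ (i, j)"
      using r by (auto simp: K_mat_def K_entry_def intro!: zero)
  qed (use A_carrier in \<open>auto simp: K_mat_def\<close>)
  show "0 \<le> ?a i" if "i < n - 1" for i
    using that by (intro nonneg) (auto simp: K_entry_def)
  show "0 \<le> ?d i" if "i < n - 1" for i
    using that nonpos[of i "i + 1"] by (auto simp: K_entry_def)
  show "0 \<le> ?c"
    using r nonpos[of "n - 1" "n - 1"] by (auto simp: K_entry_def)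
  show "0 \<le> ?b"
    using r by (intro nonneg) (auto simp: K_entry_def)
qed

section \<open>Minimality\<close>

lemma K_coeff_nonneg:
  assumes "\<And>i. i < k \<Longrightarrow> 0 \<le> a i" "\<And>i. i < k \<Longrightarrow> 0 \<le> d i"
  shows "0 \<le> K_coeff a d k"
  using assms by (auto simp: K_coeff_def intro!: mult_nonneg_nonneg prod_nonneg)

text \<open>For \<open>k \<ge> r\<close> positivity of the term of index \<open>k\<close> is read off the equation of index
  \<open>k + 1\<close>, where only it enters with a negative sign.\<close>

lemma nilpotent_recurrence_pos:
  fixes A :: "nat \<Rightarrow> real"
  assumes r: "2 \<le> r" and "0 < c" "0 < b" "A 0 = 1" and nonneg: "\<And>k. k < n \<Longrightarrow> 0 \<le> A k"
    and rec: "\<And>k. 1 \<le> k \<Longrightarrow> k \<le> n \<Longrightarrow>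
      (if k < n then A k else 0) - c * A (k - 1) + (if r \<le> k then b * A (k - r) else 0) = 0"
    and "k < n"
  shows "0 < A k"
  using \<open>k < n\<close>
proof (induction k rule: less_induct)
  case (less k)
  consider "k = 0" | "1 \<le> k" "k < r" | "r \<le> k" by linarith
  then show ?case
  proof cases
    case 1
    then show ?thesis using \<open>A 0 = 1\<close> by simp
  next
    case 2
    then have "0 < A (k - 1)" using less by simp
    then show ?thesis using rec[of k] 2 less.prems \<open>0 < c\<close> by simp
  next
    case 3
    then have "0 < A (Suc k - r)" using less r by simp
    then have "0 < b * A (Suc k - r)" using \<open>0 < b\<close> by simp
    moreover have "0 \<le> (if Suc k < n then A (Suc k) else 0)" using nonneg by simp
    ultimately have "0 < c * A k"
      using rec[of "Suc k"] 3 less.prems by auto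
    then show ?thesis using \<open>0 < c\<close> by (simp add: zero_less_mult_iff)
  qed
qed

text \<open>Three polynomials are tested in turn. Their realizations may differ, so each finding is
  recorded as an entry of T and read back from there.\<close>

lemma K_pattern_subpattern_spectrally_arbitrary:
  assumes r: "2 \<le> r" "r \<le> n"
    and T: "subpattern T (K_pattern n r)" and SA: "spectrally_arbitrary T"
  shows "T = K_pattern n r"
proof -
  let ?E = "\<lambda>d. \<Prod>i = n - r..<n - 1. d i :: real"
  have dim: "dim_row T = n" "dim_col T = n"
    using T by (auto simp: subpattern_def K_pattern_def)
  note entry = subpattern_K_pattern_entry[OF T]
  have realize: thesis
    if p: "lead_coeff p = 1" "degree p = n"
      and K: "\<And>a d c b. K_mat n r a d c b \<in> pattern_class T \<Longrightarrow>
        (\<And>k. k < n \<Longrightarrow> 0 \<le> K_coeff a d k) \<Longrightarrow> (\<And>i. i < n - 1 \<Longrightarrow> 0 \<le> a i) \<Longrightarrow>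
        (\<And>i. i < n - 1 \<Longrightarrow> 0 \<le> d i) \<Longrightarrow> 0 \<le> c \<Longrightarrow> 0 \<le> b \<Longrightarrow>
        (\<And>k. 1 \<le> k \<Longrightarrow> k \<le> n \<Longrightarrow> (if k < n then K_coeff a d k else 0) - c * K_coeff a d (k - 1) +
          (if r \<le> k then (b * ?E d) * K_coeff a d (k - r) else 0) = (-1) ^ k * coeff p (n - k)) \<Longrightarrow> thesis"
    for p :: "real poly" and thesis :: bool
  proof -
    obtain A where A: "A \<in> pattern_class T" "char_poly A = p"
      using SA p dim unfolding spectrally_arbitrary_def by metis
    obtain a d c b where *: "A = K_mat n r a d c b" "\<And>i. i < n - 1 \<Longrightarrow> 0 \<le> a i"
        "\<And>i. i < n - 1 \<Longrightarrow> 0 \<le> d i" "0 \<le> c" "0 \<le> b"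
      using subpattern_K_pattern_K_mat[OF r T A(1)] by blast
    show thesis
    proof (rule K)
      show "0 \<le> K_coeff a d k" if "k < n" for k
        using that * by (intro K_coeff_nonneg) auto
      fix k assume k: "1 \<le> k" "k \<le> n"
      show "(if k < n then K_coeff a d k else 0) - c * K_coeff a d (k - 1) +
          (if r \<le> k then (b * ?E d) * K_coeff a d (k - r) else 0) = (-1) ^ k * coeff p (n - k)"
        using coeff_char_poly_K_mat[OF r k, of a d c b] *(1) A(2) by (simp add: mult.assoc[symmetric])
    qed (use * A in auto)
  qed
  have T_cc: "T $$ (n - 1, n - 1) = Minus_sign"
  proof (rule realize)
    \<comment> \<open>For k = 1 the equation reads A_1 - c = -1, so c >= 1.\<close>
    let ?p = "monom 1 n + monom 1 (n - 1) :: real poly"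
    show "degree ?p = n" using r by (subst degree_add_eq_left) (auto simp: degree_monom_eq)
    then show "lead_coeff ?p = 1" using r by simp
    fix a d c b
    assume K: "K_mat n r a d c b \<in> pattern_class T"
      and nonneg: "\<And>k. k < n \<Longrightarrow> 0 \<le> K_coeff a d k"
      and rec: "\<And>k. 1 \<le> k \<Longrightarrow> k \<le> n \<Longrightarrow> (if k < n then K_coeff a d k else 0) - c * K_coeff a d (k - 1) +
          (if r \<le> k then (b * ?E d) * K_coeff a d (k - r) else 0) = (-1) ^ k * coeff ?p (n - k)"
    have "c > 0" using rec[of 1] nonneg[of 1] r by (auto split: if_splits)
    then have "sign_of (K_mat n r a d c b $$ (n - 1, n - 1)) = Minus_sign"
      using r by (simp add: K_mat_def sign_of_def)
    then show ?thesis using entry(1)[OF K, of "n - 1" "n - 1"] r by simp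
  qed
  have T_b_d: "T $$ (n - 1, n - r) = Plus_sign \<and> (\<forall>i\<in>{n - r..<n - 1}. T $$ (i, i + 1) = Minus_sign)"
  proof (rule realize)
    \<comment> \<open>For k = n the equation reads B A_(n-r) = 1 + c A_(n-1) > 0, so no factor of B
      vanishes.\<close>
    let ?p = "monom 1 n + monom ((-1) ^ n) 0 :: real poly"
    show "degree ?p = n" using r by (subst degree_add_eq_left) (auto simp: degree_monom_eq)
    then show "lead_coeff ?p = 1" using r by simp
    fix a d c b
    assume K: "K_mat n r a d c b \<in> pattern_class T"
      and nonneg: "\<And>k. k < n \<Longrightarrow> 0 \<le> K_coeff a d k" "\<And>i. i < n - 1 \<Longrightarrow> 0 \<le> d i" "0 \<le> c" "0 \<le> b"
      and rec: "\<And>k. 1 \<le> k \<Longrightarrow> k \<le> n \<Longrightarrow> (if k < n then K_coeff a d k else 0) - c * K_coeff a d (k - 1) +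
          (if r \<le> k then (b * ?E d) * K_coeff a d (k - r) else 0) = (-1) ^ k * coeff ?p (n - k)"
    have "0 \<le> c * K_coeff a d (n - 1)" using nonneg r by simp
    moreover have "(-1) ^ n * (-1) ^ n = (1 :: real)" by (simp flip: power_mult_distrib)
    ultimately have "0 < b * ?E d * K_coeff a d (n - r)" using rec[of n] r by simp
    then have "b * ?E d * K_coeff a d (n - r) \<noteq> 0" by (metis less_irrefl)
    then have b: "b \<noteq> 0" and "?E d \<noteq> 0" by (simp_all only: mult_eq_0_iff de_Morgan_disj not_False_eq_True)
    then have d: "0 < d i" if "i \<in> {n - r..<n - 1}" for i
      using that nonneg(2)[of i] by (auto simp: less_le)
    have "sign_of (K_mat n r a d c b $$ (n - 1, n - r)) = Plus_sign"
      using r b nonneg by (auto simp add: K_mat_def sign_of_def)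
    moreover have "T $$ (i, i + 1) = Minus_sign" if "i \<in> {n - r..<n - 1}" for i
      using entry(1)[OF K, of i "i + 1"] r d[OF that] that by (auto simp add: K_mat_def sign_of_def)
    ultimately show ?thesis
      using entry(1)[OF K, of "n - 1" "n - r"] r by auto
  qed
  have T_a_d: "\<forall>i<n - 1. T $$ (i, 0) = Plus_sign \<and> (i < n - 2 \<longrightarrow> T $$ (i, i + 1) = Minus_sign)"
  proof (rule realize)
    let ?p = "monom 1 n :: real poly"
    show "degree ?p = n" by (simp add: degree_monom_eq)
    then show "lead_coeff ?p = 1" by simp
    fix a d c b
    assume K: "K_mat n r a d c b \<in> pattern_class T"
      and nonneg: "\<And>k. k < n \<Longrightarrow> 0 \<le> K_coeff a d k" "\<And>i. i < n - 1 \<Longrightarrow> 0 \<le> a i"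
        "\<And>i. i < n - 1 \<Longrightarrow> 0 \<le> d i" "0 \<le> c" "0 \<le> b"
      and rec: "\<And>k. 1 \<le> k \<Longrightarrow> k \<le> n \<Longrightarrow> (if k < n then K_coeff a d k else 0) - c * K_coeff a d (k - 1) +
          (if r \<le> k then (b * ?E d) * K_coeff a d (k - r) else 0) = (-1) ^ k * coeff ?p (n - k)"
    have c: "0 < c"
      using entry(1)[OF K, of "n - 1" "n - 1"] T_cc r
      by (auto simp: K_mat_def sign_of_def split: if_splits)
    have b: "0 < b"
      using entry(1)[OF K, of "n - 1" "n - r"] T_b_d r
      by (auto simp: K_mat_def sign_of_def split: if_splits)
    have "0 < d i" if i: "i \<in> {n - r..<n - 1}" for i
    proof -
      have "i < n - 1" "i < n" "i + 1 < n" using i by auto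
      then have "sign_of (- d i) = Minus_sign"
        using entry(1)[OF K, of i "i + 1"] T_b_d i by (simp add: K_mat_def)
      then show ?thesis by (auto simp: sign_of_def split: if_splits)
    qed
    then have bE: "0 < b * ?E d" using b by (intro mult_pos_pos prod_pos) auto
    have pos: "0 < K_coeff a d k" if "k < n" for k
    proof (rule nilpotent_recurrence_pos[OF r(1) c bE, where n = n])
      fix k assume k: "1 \<le> k" "k \<le> n"
      then have "coeff ?p (n - k) = 0" by simp
      then show "(if k < n then K_coeff a d k else 0) - c * K_coeff a d (k - 1) +
          (if r \<le> k then (b * ?E d) * K_coeff a d (k - r) else 0) = 0"
        using rec[OF k] by (simp only: mult_zero_right)
    qed (use that nonneg(1) in auto)
    have a: "0 < a i" if "i < n - 1" for i
    proof -
      have "Suc i < n" using that by simp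
      then have "a i \<noteq> 0" using pos[of "Suc i"] by (auto simp: K_coeff_def)
      then show ?thesis using nonneg(2)[OF that] by simp
    qed
    \<comment> \<open>A_(n-1) contains every superdiagonal parameter except the last one.\<close>
    have d: "0 < d i" if "i < n - 2" for i
    proof -
      have "n - 1 - 1 = n - 2" "n - 1 \<noteq> 0" "n - 1 < n" using that by auto
      then have "0 < a (n - 2) * (\<Prod>i<n - 2. d i)"
        using pos[of "n - 1"] by (simp only: K_coeff_def if_False)
      then have "(\<Prod>i<n - 2. d i) \<noteq> 0" by (metis less_irrefl mult_zero_right)
      then have "d i \<noteq> 0" using that by simp
      moreover have "i < n - 1" using that by simp
      ultimately show ?thesis using nonneg(3)[of i] by simp
    qed
    have "T $$ (i, 0) = Plus_sign" if "i < n - 1" for i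
      using entry(1)[OF K, of i 0] that a[of i] r by (auto simp: K_mat_def sign_of_def)
    moreover have "T $$ (i, i + 1) = Minus_sign" if "i < n - 2" for i
    proof -
      have "i < n - 1" "i < n" "i + 1 < n" using that by auto
      then show ?thesis
        using entry(1)[OF K, of i "i + 1"] d[OF that] by (simp add: K_mat_def sign_of_def)
    qed
    ultimately show ?thesis by blast
  qed
  show ?thesis
  proof (rule eq_matI)
    fix i j assume "i < dim_row (K_pattern n r)" "j < dim_col (K_pattern n r)"
    then have ij: "i < n" "j < n" by (auto simp: K_pattern_def)
    \<comment> \<open>The last superdiagonal entry, i = n - 2, is a factor of B because r >=
      2.\<close>
    have T_d: "T $$ (i, Suc i) = Minus_sign" if "i < n - 1"
      using T_a_d T_b_d that r by (cases "i < n - 2") auto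
    have "T $$ (i, j) = K_entry n r (i + 1) (j + 1)"
    proof (cases "K_entry n r (i + 1) (j + 1) = Zero_sign")
      case True
      then show ?thesis
        using T ij dim by (cases "T $$ (i, j) = Zero_sign") (auto simp: subpattern_def K_pattern_def)
    next
      case False
      then show ?thesis
        using T_cc T_b_d T_a_d T_d ij r by (auto simp: K_entry_def split: if_splits)
    qed
    then show "T $$ (i, j) = K_pattern n r $$ (i, j)" using ij by (simp add: K_pattern_def)
  qed (use dim in \<open>auto simp: K_pattern_def\<close>)
qed

section \<open>The rescaled recursion\<close>

text \<open>Here \<open>s\<close> stands for \<open>r - 1\<close>, which makes the recursion terminate for every value of
  the parameter.\<close>

fun K_seq :: "nat \<Rightarrow> (nat \<Rightarrow> real) \<Rightarrow> real \<Rightarrow> nat \<Rightarrow> real" where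
  "K_seq s h x 0 = 1"
| "K_seq s h x (Suc k) = K_seq s h x k - (if s \<le> k then x * K_seq s h x (k - s) else 0) + h (Suc k)"

lemma continuous_on_K_seq: "continuous_on S (\<lambda>x. K_seq s h x k)"
proof (induction k rule: less_induct)
  case (less k)
  then show ?case by (cases k; cases "s \<le> k - 1") (auto intro!: continuous_intros)
qed

lemma K_seq_at_0: "K_seq s (\<lambda>_. 0) 0 k = 1"
  by (induction k) auto

lemma K_seq_small: "k \<le> s \<Longrightarrow> K_seq s (\<lambda>_. 0) x k = 1"
  by (induction k) auto

text \<open>At the first point where the term of index \<open>k\<close> is not positive, the recursion makes the
  next term negative, so a slightly smaller interval serves for \<open>k + 1\<close>.\<close>

lemma K_seq_sign_change:
  assumes s: "1 \<le> s" and "Suc s \<le> k"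
  shows "\<exists>u>0. (\<forall>j<k. \<forall>x\<in>{0..u}. 0 < K_seq s (\<lambda>_. 0) x j) \<and> K_seq s (\<lambda>_. 0) u k < 0"
  using assms(2)
proof (induction k rule: dec_induct)
  case base
  \<comment> \<open>The term of index s + 1 is 1 - x, negative at x = 2.\<close>
  show ?case by (intro exI[of _ 2]) (auto simp: K_seq_small)
next
  case (step k)
  let ?g = "K_seq s (\<lambda>_. 0)"
  obtain u where u: "0 < u" "\<And>j x. j < k \<Longrightarrow> 0 \<le> x \<Longrightarrow> x \<le> u \<Longrightarrow> 0 < ?g x j" "?g u k < 0"
    using step.IH by force
  define Z where "Z = {0..u} \<inter> {x. ?g x k \<le> 0}"
  have "closed {x. ?g x k \<le> 0}"
    by (intro closed_Collect_le continuous_on_K_seq continuous_intros)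
  then have "compact Z" unfolding Z_def by (intro compact_Int_closed) auto
  moreover have "u \<in> Z" using u by (simp add: Z_def)
  ultimately obtain z where z: "z \<in> Z" "\<And>x. x \<in> Z \<Longrightarrow> z \<le> x"
    using compact_attains_inf[of Z] by auto
  have "0 < z" using z K_seq_at_0[of s k] by (cases "z = 0") (auto simp: Z_def)
  moreover have "0 < ?g z (k - s)" using u(2)[of "k - s" z] z s step by (simp add: Z_def)
  ultimately have "0 < z * ?g z (k - s)" by simp
  \<comment> \<open>At z the term of index k is at most 0, and a positive quantity is subtracted
    from it. By continuity the sign persists slightly to the left of z, where the term of index k is
    still positive.\<close>
  then have neg: "?g z (Suc k) < 0" using z(1) step by (simp add: Z_def)
  have "isCont (\<lambda>x. ?g x (Suc k)) z"
    using continuous_on_K_seq[of UNIV] by (simp add: continuous_on_eq_continuous_at del: K_seq.simps)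
  then have "((\<lambda>x. ?g x (Suc k)) \<longlongrightarrow> ?g z (Suc k)) (at_left z)"
    unfolding isCont_def by (rule filterlim_mono) (auto intro: at_le)
  then have "\<forall>\<^sub>F x in at_left z. ?g x (Suc k) < 0"
    using neg order_tendstoD(2) by blast
  moreover have "\<forall>\<^sub>F x in at_left z. x \<in> {0<..<z}"
    using \<open>0 < z\<close> by (rule eventually_at_left_real)
  ultimately have "\<forall>\<^sub>F x in at_left z. ?g x (Suc k) < 0 \<and> x \<in> {0<..<z}"
    by (rule eventually_conj)
  then obtain v where v: "?g v (Suc k) < 0" "0 < v" "v < z"
    using eventually_happens'[OF trivial_limit_at_left_real] by fastforce
  have "0 < ?g x j" if "j < Suc k" "0 \<le> x" "x \<le> v" for j x
  proof (cases "j = k")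
    case True
    have "x \<notin> Z" using z(2)[of x] v that by auto
    then show ?thesis using True that v z(1) by (auto simp: Z_def)
  next
    case False
    then show ?thesis using u(2)[of j x] that v z(1) by (auto simp: Z_def)
  qed
  with v show ?case by (intro exI[of _ v]) auto
qed

text \<open>The error obeys the same linear recursion with source q_k e^k, which is at most |q_k| e
  in absolute value for k >= 1 and e in [0, 1]. The bound is uniform in x.\<close>

lemma K_seq_perturbation:
  assumes "0 \<le> u"
  shows "\<exists>C\<ge>0. \<forall>x\<in>{0..u}. \<forall>e\<in>{0..1}.
    \<bar>K_seq s (\<lambda>k. q k * e ^ k) x k - K_seq s (\<lambda>_. 0) x k\<bar> \<le> C * e"
proof (induction k rule: less_induct)
  case (less k)
  let ?d = "\<lambda>e x k. K_seq s (\<lambda>k. q k * e ^ k) x k - K_seq s (\<lambda>_. 0) x k"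
  show ?case
  proof (cases k)
    case 0
    then show ?thesis by auto
  next
    case (Suc l)
    obtain C where C: "0 \<le> C" "\<And>x e. x \<in> {0..u} \<Longrightarrow> e \<in> {0..1} \<Longrightarrow> \<bar>?d e x l\<bar> \<le> C * e"
      using less[of l] Suc by auto
    obtain C' where C': "0 \<le> C'" "\<And>x e. x \<in> {0..u} \<Longrightarrow> e \<in> {0..1} \<Longrightarrow> \<bar>?d e x (l - s)\<bar> \<le> C' * e"
      using less[of "l - s"] Suc by (auto simp: less_Suc_eq_le)
    have "\<bar>?d e x k\<bar> \<le> (C + u * C' + \<bar>q k\<bar>) * e" if x: "x \<in> {0..u}" and e: "e \<in> {0..1}" for x e
    proof -
      have "\<bar>?d e x k\<bar> = \<bar>?d e x l - (if s \<le> l then x * ?d e x (l - s) else 0) + q k * e ^ k\<bar>"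
        using Suc by (simp add: algebra_simps)
      also have "\<dots> \<le> \<bar>?d e x l\<bar> + \<bar>x * ?d e x (l - s)\<bar> + \<bar>q k * e ^ k\<bar>"
        by auto
      also have "\<bar>x * ?d e x (l - s)\<bar> \<le> u * (C' * e)"
        unfolding abs_mult using x e C'(2)[OF x e] by (intro mult_mono) auto
      also have "\<bar>q k * e ^ k\<bar> \<le> \<bar>q k\<bar> * e"
        using e Suc by (auto simp: abs_mult intro!: mult_left_mono mult_left_le power_le_one)
      also have "\<bar>?d e x l\<bar> \<le> C * e" by (rule C(2)[OF x e])
      finally show ?thesis by (simp add: algebra_simps)
    qed
    moreover have "0 \<le> C + u * C' + \<bar>q k\<bar>" using C C' assms by simp
    ultimately show ?thesis by blast
  qed
qed

lemma K_seq_perturbation_eventually: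
  assumes "0 \<le> u" "0 < m"
  shows "\<forall>\<^sub>F e in at_right 0. \<forall>x\<in>{0..u}.
    \<bar>K_seq s (\<lambda>k. q k * e ^ k) x k - K_seq s (\<lambda>_. 0) x k\<bar> < m"
proof -
  obtain C where C: "0 \<le> C" "\<And>x e. x \<in> {0..u} \<Longrightarrow> e \<in> {0..1} \<Longrightarrow>
      \<bar>K_seq s (\<lambda>k. q k * e ^ k) x k - K_seq s (\<lambda>_. 0) x k\<bar> \<le> C * e"
    using K_seq_perturbation[OF assms(1)] by metis
  have "((\<lambda>e. C * e) \<longlongrightarrow> C * 0) (at_right 0)" by (intro tendsto_intros)
  then have "\<forall>\<^sub>F e in at_right 0. C * e < m"
    using \<open>0 < m\<close> by (intro order_tendstoD(2)) auto
  moreover have "\<forall>\<^sub>F e in at_right 0. e \<in> {0<..<1::real}"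
    by (rule eventually_at_right_real) simp
  ultimately show ?thesis
  proof eventually_elim
    case (elim e)
    then have "\<bar>K_seq s (\<lambda>k. q k * e ^ k) x k - K_seq s (\<lambda>_. 0) x k\<bar> \<le> C * e" if "x \<in> {0..u}" for x
      using that by (intro C(2)) auto
    with elim(1) show ?case using le_less_trans by blast
  qed
qed

lemma K_seq_root:
  assumes s: "1 \<le> s" and n: "Suc s \<le> n"
  obtains e x where "0 < e" "0 < x" "\<And>k. k < n \<Longrightarrow> 0 < K_seq s (\<lambda>k. q k * e ^ k) x k"
    "K_seq s (\<lambda>k. q k * e ^ k) x n = 0"
proof -
  let ?f = "K_seq s (\<lambda>_. 0)" and ?g = "\<lambda>e. K_seq s (\<lambda>k. q k * e ^ k)"
  obtain u where u: "0 < u" "\<And>j x. j < n \<Longrightarrow> x \<in> {0..u} \<Longrightarrow> 0 < ?f x j" "?f u n < 0"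
    using K_seq_sign_change[OF s n] by blast
  have "\<forall>\<^sub>F e in at_right 0. \<forall>x\<in>{0..u}. 0 < ?g e x j" if "j \<in> {..<n}" for j
  proof -
    \<comment> \<open>By compactness the unperturbed term has a positive minimum on the interval,
      and an error below it preserves positivity.\<close>
    obtain y where y: "y \<in> {0..u}" "\<And>x. x \<in> {0..u} \<Longrightarrow> ?f y j \<le> ?f x j"
      using continuous_attains_inf[OF compact_Icc _ continuous_on_K_seq, of 0 u s "\<lambda>_. 0" j] u(1) by auto
    have "\<forall>\<^sub>F e in at_right 0. \<forall>x\<in>{0..u}. \<bar>?g e x j - ?f x j\<bar> < ?f y j"
      using u y that by (intro K_seq_perturbation_eventually) auto
    then show ?thesis by eventually_elim (use y(2) in fastforce)
  qed
  then have "\<forall>\<^sub>F e in at_right 0. \<forall>j\<in>{..<n}. \<forall>x\<in>{0..u}. 0 < ?g e x j"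
    by (intro eventually_ball_finite) auto
  \<comment> \<open>One bound for both endpoints: the unperturbed value is 1 at x = 0 and negative
    at x = u.\<close>
  moreover have "\<forall>\<^sub>F e in at_right 0. \<forall>x\<in>{0..u}. \<bar>?g e x n - ?f x n\<bar> < min 1 (- ?f u n)"
    using u by (intro K_seq_perturbation_eventually) auto
  moreover have "\<forall>\<^sub>F e in at_right 0. e \<in> {0<..<1::real}"
    by (rule eventually_at_right_real) simp
  ultimately have "\<forall>\<^sub>F e in at_right 0. 0 < e \<and> (\<forall>j<n. \<forall>x\<in>{0..u}. 0 < ?g e x j) \<and>
      (\<forall>x\<in>{0..u}. \<bar>?g e x n - ?f x n\<bar> < min 1 (- ?f u n))"
    by eventually_elim auto
  then obtain e where e: "0 < e" "\<And>j x. j < n \<Longrightarrow> x \<in> {0..u} \<Longrightarrow> 0 < ?g e x j"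
      "\<And>x. x \<in> {0..u} \<Longrightarrow> \<bar>?g e x n - ?f x n\<bar> < min 1 (- ?f u n)"
    using eventually_happens'[OF trivial_limit_at_right_real] by blast
  have "?g e u n < 0" "0 < ?g e 0 n"
    using e(3)[of u] e(3)[of 0] u(1) by (auto simp: K_seq_at_0)
  moreover obtain x where x: "0 \<le> x" "x \<le> u" "?g e x n = 0"
    using IVT2'[of "\<lambda>x. ?g e x n" u 0 0] calculation u(1) continuous_on_K_seq by (auto simp: less_imp_le)
  ultimately have "0 < x" by (cases "x = 0") auto
  with x e show thesis by (intro that[of e x]) auto
qed

section \<open>Spectral arbitrariness\<close>

lemma K_pattern_spectrally_arbitrary:
  assumes r: "2 \<le> r" "r \<le> n"
  shows "spectrally_arbitrary (K_pattern n r)"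
  unfolding spectrally_arbitrary_def
proof (intro conjI allI impI)
  show "square_mat (K_pattern n r)" by (simp add: K_pattern_def)
  fix p :: "real poly"
  assume "lead_coeff p = 1 \<and> degree p = dim_row (K_pattern n r)"
  then have p: "lead_coeff p = 1" "degree p = n" by (auto simp: K_pattern_def)
  define q where "q k = (-1) ^ k * coeff p (n - k)" for k
  have r': "1 \<le> r - 1" "Suc (r - 1) \<le> n" using r by auto
  obtain e x where e: "0 < e" and x: "0 < x"
    and pos: "\<And>k. k < n \<Longrightarrow> 0 < K_seq (r - 1) (\<lambda>k. q k * e ^ k) x k"
    and root: "K_seq (r - 1) (\<lambda>k. q k * e ^ k) x n = 0"
    by (rule K_seq_root[OF r', of q]) (rule that; assumption)
  let ?g = "K_seq (r - 1) (\<lambda>k. q k * e ^ k) x"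
  \<comment> \<open>With all d equal to 1, A_k is \<open>a (k - 1)\<close>, hence the shift.\<close>
  define a where "a i = ?g (Suc i) / e ^ Suc i" for i
  let ?A = "K_mat n r a (\<lambda>_. 1) (1 / e) (x / e ^ r)"
  have K_coeff: "K_coeff a (\<lambda>_. 1) k = ?g k / e ^ k" for k
    by (cases k) (auto simp: K_coeff_def a_def)
  have "coeff (char_poly ?A) j = coeff p j" for j
  proof -
    \<comment> \<open>The coefficient formula covers only k >= 1; the leading coefficient and those
      above it are settled by monicity and degree.\<close>
    have monic: "degree (char_poly ?A) = n" "coeff (char_poly ?A) n = 1"
      using degree_monic_char_poly[OF carrier_K_mat] by auto
    consider "n \<le> j" | k where "1 \<le> k" "k \<le> n" "j = n - k"
      by (metis diff_diff_cancel diff_le_self le_cases less_one linorder_not_less diff_is_0_eq)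
    then show ?thesis
    proof cases
      case 1
      then show ?thesis
        using p monic by (cases "j = n") (auto simp: coeff_eq_0)
    next
      case (2 k)
      obtain l where l: "k = Suc l" using 2 by (cases k) auto
      let ?b = "if r \<le> k then x * ?g (k - r) else 0"
      have "?g k = ?g l - ?b + q k * e ^ k"
        using r by (auto simp: l)
      then have "q k = (?g k - ?g l + ?b) / e ^ k"
        using e by (simp del: K_seq.simps)
      then have "q k = ?g k / e ^ k - ?g l / e ^ k + ?b / e ^ k"
        by (simp only: add_divide_distrib diff_divide_distrib)
      \<comment> \<open>For k = n this is g_n = 0, the reason for choosing x as a root.\<close>
      moreover have "(if k < n then ?g k / e ^ k else 0) = ?g k / e ^ k"
        using root 2 by auto
      moreover have "(if r \<le> k then x / e ^ r * (?g (k - r) / e ^ (k - r)) else 0) = ?b / e ^ k"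
        by (simp flip: power_add)
      moreover have "1 / e * (?g (k - 1) / e ^ (k - 1)) = ?g l / e ^ k"
        by (simp add: l)
      ultimately have "(if k < n then ?g k / e ^ k else 0) - 1 / e * (?g (k - 1) / e ^ (k - 1)) +
          (if r \<le> k then x / e ^ r * (?g (k - r) / e ^ (k - r)) else 0) = q k"
        by (simp only:)
      then have "coeff (char_poly ?A) (n - k) = (-1) ^ k * q k"
        using coeff_char_poly_K_mat[OF r 2(1,2), of a "\<lambda>_. 1" "1 / e" "x / e ^ r"]
        by (simp only: K_coeff prod.neutral_const mult_1_right)
      then show ?thesis
        using 2 by (simp add: q_def flip: mult.assoc power_mult_distrib)
    qed
  qed
  then have "char_poly ?A = p" by (rule poly_eqI)
  moreover have "?A \<in> pattern_class (K_pattern n r)"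
    using r e x pos by (intro K_mat_in_pattern_class) (auto simp: a_def simp del: K_seq.simps)
  ultimately show "\<exists>A\<in>pattern_class (K_pattern n r). char_poly A = p" by blast
qed

theorem theorem3p7:
  fixes n r :: nat
  assumes "2 \<le> r" and "r \<le> n"
  shows "minimal_spectrally_arbitrary (K_pattern n r)"
  unfolding minimal_spectrally_arbitrary_def proper_subpattern_def
  using K_pattern_spectrally_arbitrary[OF assms]
    K_pattern_subpattern_spectrally_arbitrary[OF assms] by blast

end
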